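(* Let $D$ be a differentiable right-convex divergence on $\mathcal{P}$. Then $\Psi^{-1}[D]$ is a divergence, and $\Psi^{k}[D]$ is a right-convex divergence for every integer $k\ge1$. They constitute a monotonically decreasing (i.e. non-increasing) sequence: for all $P,Q\in\mathcal{P}$ and $t\in[0,1]$, with $R(t)=(Q-P)t+P$, $$\Psi^{-1}[D](P\|R(t))\geq D(P\|R(t))\geq\Psi[D](P\|R(t))\geq\Psi^{2}[D](P\|R(t))\geq\cdots\geq\Psi^{k}[D](P\|R(t))\geq\cdots\geq0 .$$ If $P\neq Q$, then $t\mapsto\Psi^{-1}[D](P\|R(t))$ and, for every $k\ge1$, $t\mapsto\Psi^{k}[D](P\|R(t))$ are strictly increasing on $[0,1]$.
   Context: $(\Sigma,\mathcal{M})$ is a measurable space and $\mathcal{P}$ is the set of probability distributions (measures) on it with common support. A divergence is a function $D:\mathcal{P}\times\mathcal{P}\to[0,\infty]$ such that, for all $P,Q\in\mathcal{P}$, $D(P\|Q)\ge 0$, and $D(P\|Q)=0$ if and only if $P=Q$. It is right-convex if it is convex in the second argument: $\lambda D(P\|Q_1)+(1-\lambda)D(P\|Q_2)\ge D(P\|\lambda Q_1+(1-\lambda)Q_2)$ for all $P,Q_1,Q_2\in\mathcal{P}$ and $\lambda\in[0,1]$. For $P,Q\in\mathcal{P}$ and $t\in[0,1]$, $R(t):=(Q-P)t+P\in\mathcal{P}$ denotes the mixture distribution. $D$ is differentiable if, for all $P,Q\in\mathcal{P}$, the function $t\mapsto D(P\|R(t))$ is differentiable on $[0,1]$ (one-sided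 derivatives at the endpoints); in particular it is finite. Integral operator: when $\frac1t D(P\|R(t))$ is integrable on $[0,1]$ (Lebesgue measure), define $\Psi[D](P\|R(t)):=\int_0^t\frac1s D(P\|R(s))\,ds$. Iterates: $\Psi^0$ is the identity operator and $\Psi^{k+1}:=\Psi\circ\Psi^k$ for $k\ge0$. Differential operator: for differentiable $D$, define $\Psi^{-1}[D](P\|R(t)):=t\frac{d}{dt}D(P\|R(t))$. Both right-hand sides depend only on $P$ and the distribution $R(t)$, so $\Psi[D]$ and $\Psi^{-1}[D]$ are well-defined functions on $\mathcal{P}\times\mathcal{P}$; equivalently, $\Psi[D](P\|Q)=\int_0^1\frac1s D(P\|(Q-P)s+P)\,ds$ and $\Psi^{-1}[D](P\|Q)=\frac{d}{ds}D(P\|(Q-P)s+P)\big|_{s=1}$. *)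

theory Defs
  imports "HOL-Probability.Probability_Measure"
begin

(* No topology or dominating measure is given, so "common support" is read measure-theoretically:
   all probability measures with the same null sets as a reference measure. *)
definition common_support_probs :: "'a measure \<Rightarrow> 'a measure set" where
  "common_support_probs \<mu> =
     {P. prob_space P \<and> sets P = sets \<mu> \<and> null_sets P = null_sets \<mu>}"

(* (Q - P) t + P, for t in [0,1]. *)
definition mixture :: "real \<Rightarrow> 'a measure \<Rightarrow> 'a measure \<Rightarrow> 'a measure" where
  "mixture t P Q = measure_of (space P) (sets P)
     (\<lambda>A. ennreal (1 - t) * emeasure P A + ennreal t * emeasure Q A)"

(* The codomain is ereal rather than ennreal so that the nonnegativity of a divergence is a
   genuine requirement and not enforced by truncation. *)
definition divergence :: "'a measure set \<Rightarrow> ('a measure \<Rightarrow> 'a measure \<Rightarrow> ereal) \<Rightarrow> bool" where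
  "divergence \<P> D \<longleftrightarrow> (\<forall>P\<in>\<P>. \<forall>Q\<in>\<P>. D P Q \<ge> 0 \<and> (D P Q = 0 \<longleftrightarrow> P = Q))"

definition right_convex :: "'a measure set \<Rightarrow> ('a measure \<Rightarrow> 'a measure \<Rightarrow> ereal) \<Rightarrow> bool" where
  "right_convex \<P> D \<longleftrightarrow>
     (\<forall>P\<in>\<P>. \<forall>Q1\<in>\<P>. \<forall>Q2\<in>\<P>. \<forall>l\<in>{0..1::real}.
        ereal l * D P Q1 + ereal (1 - l) * D P Q2 \<ge> D P (mixture l Q2 Q1))"

definition divergence_differentiable ::
    "'a measure set \<Rightarrow> ('a measure \<Rightarrow> 'a measure \<Rightarrow> ereal) \<Rightarrow> bool" where
  "divergence_differentiable \<P> D \<longleftrightarrow>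
     (\<forall>P\<in>\<P>. \<forall>Q\<in>\<P>.
        (\<forall>t\<in>{0..1}. \<bar>D P (mixture t P Q)\<bar> \<noteq> \<infinity>) \<and>
        (\<lambda>t. real_of_ereal (D P (mixture t P Q))) differentiable_on {0..1})"

(* The operators are defined at the endpoint t = 1 of the mixture path; Psi_mixture and
   Psi_inv_mixture below give the values along the path. *)

definition Psi_integrable ::
    "'a measure set \<Rightarrow> ('a measure \<Rightarrow> 'a measure \<Rightarrow> ereal) \<Rightarrow> bool" where
  "Psi_integrable \<P> D \<longleftrightarrow>
     (\<forall>P\<in>\<P>. \<forall>Q\<in>\<P>.
        (AE t in lebesgue. t \<in> {0..1} \<longrightarrow> \<bar>D P (mixture t P Q)\<bar> \<noteq> \<infinity>) \<and>
        (\<lambda>t. 1 / t * real_of_ereal (D P (mixture t P Q))) absolutely_integrable_on {0..1})"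

(* Meaningful only under Psi_integrable: real_of_ereal sends infinite values to 0, and the
   integral of a non-integrable function is 0. *)
definition Psi :: "('a measure \<Rightarrow> 'a measure \<Rightarrow> ereal) \<Rightarrow> 'a measure \<Rightarrow> 'a measure \<Rightarrow> ereal" where
  "Psi D P Q =
     ereal (LINT s:{0..1}|lebesgue. 1 / s * real_of_ereal (D P (mixture s P Q)))"

definition Psi_inv :: "('a measure \<Rightarrow> 'a measure \<Rightarrow> ereal) \<Rightarrow> 'a measure \<Rightarrow> 'a measure \<Rightarrow> ereal" where
  "Psi_inv D P Q =
     ereal (vector_derivative (\<lambda>s. real_of_ereal (D P (mixture s P Q))) (at 1 within {0..1}))"

lemma sets_mixture [simp]: "sets (mixture t P Q) = sets P"
  by (simp add: mixture_def)

lemma space_mixture [simp]: "space (mixture t P Q) = space P"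
  by (simp add: mixture_def)

lemma emeasure_mixture:
  assumes "sets Q = sets P" "A \<in> sets P"
  shows "emeasure (mixture t P Q) A = ennreal (1 - t) * emeasure P A + ennreal t * emeasure Q A"
proof -
  have "countably_additive (sets P)
      (\<lambda>A. ennreal (1 - t) * emeasure P A + ennreal t * emeasure Q A)"
    using assms
    by (auto simp: countably_additive_def suminf_add[symmetric] suminf_emeasure)
  then show ?thesis
    unfolding mixture_def using assms
    by (intro emeasure_measure_of_sigma) (auto simp: positive_def sets.sigma_algebra_axioms)
qed

lemma mixture_in_common_support_probs:
  assumes "P \<in> common_support_probs \<mu>" "Q \<in> common_support_probs \<mu>" "t \<in> {0..1}"
  shows "mixture t P Q \<in> common_support_probs \<mu>"
proof -
  have s: "sets P = sets \<mu>" "sets Q = sets \<mu>" "null_sets P = null_sets \<mu>"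
      "null_sets Q = null_sets \<mu>" and p: "prob_space P" "prob_space Q"
    using assms by (auto simp: common_support_probs_def)
  have sp: "space Q = space P"
    using s sets_eq_imp_space_eq by metis
  have "emeasure (mixture t P Q) (space P) = ennreal (1 - t) + ennreal t"
    using s prob_space.emeasure_space_1[OF p(1)] prob_space.emeasure_space_1[OF p(2)] sp
    by (subst emeasure_mixture) auto
  also have "\<dots> = 1"
    using assms(3) by (simp flip: ennreal_plus)
  finally have 1: "prob_space (mixture t P Q)"
    by (intro prob_spaceI) simp
  have "A \<in> null_sets (mixture t P Q) \<longleftrightarrow> A \<in> null_sets \<mu>" for A
  proof (cases "A \<in> sets P")
    case True
    have "emeasure P A = 0 \<longleftrightarrow> A \<in> null_sets \<mu>" "emeasure Q A = 0 \<longleftrightarrow> A \<in> null_sets \<mu>"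
      using True s by (auto simp: null_sets_def)
    moreover have "ennreal (1 - t) \<noteq> 0 \<or> ennreal t \<noteq> 0"
      using assms(3) by auto
    ultimately show ?thesis
      using True s by (auto simp: null_sets_def emeasure_mixture)
  qed (use s in \<open>auto simp: null_sets_def\<close>)
  then show ?thesis
    using 1 s by (auto simp: common_support_probs_def)
qed

lemma mixture_mixture:
  assumes "sets Q = sets P" "t \<in> {0..1}" "s \<in> {0..1}"
  shows "mixture s P (mixture t P Q) = mixture (s * t) P Q"
proof (rule measure_eqI)
  fix A assume "A \<in> sets (mixture s P (mixture t P Q))"
  then have A: "A \<in> sets P" by simp
  have *: "ennreal (1 - s) + ennreal s * ennreal (1 - t) = ennreal (1 - s * t)"
  proof -
    have "s * t \<le> s"
      using assms by (intro mult_left_le) auto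
    then show ?thesis
      using assms by (simp add: right_diff_distrib flip: ennreal_mult ennreal_plus)
  qed
  have "emeasure (mixture s P (mixture t P Q)) A =
      (ennreal (1 - s) + ennreal s * ennreal (1 - t)) * emeasure P A
        + ennreal s * ennreal t * emeasure Q A"
    using assms A by (simp add: emeasure_mixture algebra_simps)
  also have "\<dots> = emeasure (mixture (s * t) P Q) A"
    using assms A unfolding * by (simp add: emeasure_mixture ennreal_mult)
  finally show "emeasure (mixture s P (mixture t P Q)) A = emeasure (mixture (s * t) P Q) A" .
qed simp

lemma mixture_0 [simp]: "sets Q = sets P \<Longrightarrow> mixture 0 P Q = P"
  by (rule measure_eqI) (auto simp: emeasure_mixture)

lemma mixture_1 [simp]: "sets Q = sets P \<Longrightarrow> mixture 1 P Q = Q"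
  by (rule measure_eqI) (auto simp: emeasure_mixture)

lemma Psi_mixture:
  assumes "divergence (common_support_probs \<mu>) D"
    and "Psi_integrable (common_support_probs \<mu>) D"
    and "P \<in> common_support_probs \<mu>" "Q \<in> common_support_probs \<mu>" "t \<in> {0..1}"
  shows "Psi D P (mixture t P Q) =
    ereal (LINT s:{0..t}|lebesgue. 1 / s * real_of_ereal (D P (mixture s P Q)))"
proof -
  define f where "f Q s = 1 / s * real_of_ereal (D P (mixture s P Q))" for Q s
  have sets: "sets Q = sets P"
    using assms by (auto simp: common_support_probs_def)
  have int: "f Q' absolutely_integrable_on {0..1}" if "Q' \<in> common_support_probs \<mu>" for Q'
    using assms that unfolding Psi_integrable_def f_def by blast
  have int1: "f Q absolutely_integrable_on {0..t}"
    using int[OF assms(4)] assms(5) by (auto intro: absolutely_integrable_on_subinterval)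
  have int2: "f (mixture t P Q) absolutely_integrable_on {0..1}"
    using assms by (intro int mixture_in_common_support_probs)
  have eq: "f (mixture t P Q) s = t * f Q (s * t)" if "s \<in> {0..1}" "t \<noteq> 0" for s
    using that assms(5) sets by (simp add: f_def mixture_mixture)
  have "integral {0..1} (f (mixture t P Q)) = integral {0..t} (f Q)"
  proof (cases "t = 0")
    case True
    have "D P P = 0"
      using assms(1,3) unfolding divergence_def by blast
    then have "f P s = 0" if "s \<in> {0..1}" for s
      using mixture_mixture[of P P 0 s] that by (simp add: f_def)
    then have "integral {0..1} (f P) = 0"
      using integral_cong[of "{0..1}" "f P" "\<lambda>_. 0"] by simp
    then show ?thesis using True sets by simp
  next
    case False
    then have t: "t > 0" using assms(5) by auto
    have "(f Q has_integral integral {0..t} (f Q)) (cbox 0 t)"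
      using int1 by (simp add: absolutely_integrable_on_def integrable_integral)
    from has_integral_affinity[OF this, of t 0]
    have "((\<lambda>s. f Q (t * s)) has_integral integral {0..t} (f Q) / t) {0..1}"
      using t by (simp add: image_affinity_atLeastAtMost_div)
    from has_integral_mult_right[OF this, of t]
    have "((\<lambda>s. t * f Q (t * s)) has_integral integral {0..t} (f Q)) {0..1}"
      using t by simp
    then have "(f (mixture t P Q) has_integral integral {0..t} (f Q)) {0..1}"
      by (rule has_integral_eq[rotated]) (use eq t in \<open>simp add: mult.commute\<close>)
    then show ?thesis by (rule integral_unique)
  qed
  then show ?thesis
    unfolding Psi_def
    using set_lebesgue_integral_eq_integral(2)[OF int1] set_lebesgue_integral_eq_integral(2)[OF int2]
    by (simp add: f_def)
qed

lemma Psi_inv_mixture: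
  assumes "divergence_differentiable (common_support_probs \<mu>) D"
    and "P \<in> common_support_probs \<mu>" "Q \<in> common_support_probs \<mu>" "t \<in> {0..1}"
  shows "Psi_inv D P (mixture t P Q) =
    ereal (t * vector_derivative (\<lambda>s. real_of_ereal (D P (mixture s P Q))) (at t within {0..1}))"
proof -
  define f where "f Q s = real_of_ereal (D P (mixture s P Q))" for Q s
  have sets: "sets Q = sets P"
    using assms by (auto simp: common_support_probs_def)
  have "f Q differentiable at t within {0..1}"
    using assms unfolding divergence_differentiable_def f_def differentiable_on_def by blast
  then have "(f Q has_vector_derivative vector_derivative (f Q) (at t within {0..1}))
      (at (1 * t) within (\<lambda>s. s * t) ` {0..1})"
    using assms(4)
    by (auto simp: vector_derivative_works mult_le_one intro: has_vector_derivative_within_subset)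
  moreover have "((\<lambda>s. s * t) has_vector_derivative t) (at 1 within {0..1})"
    by (auto intro!: derivative_eq_intros)
  ultimately have "(f Q \<circ> (\<lambda>s. s * t) has_vector_derivative
      t *\<^sub>R vector_derivative (f Q) (at t within {0..1})) (at 1 within {0..1})"
    by (intro vector_diff_chain_within) auto
  then have "(f (mixture t P Q) has_vector_derivative
      t *\<^sub>R vector_derivative (f Q) (at t within {0..1})) (at 1 within {0..1})"
    by (rule has_vector_derivative_transform[rotated 2])
      (use assms(4) sets in \<open>auto simp: f_def mixture_mixture\<close>)
  then have "vector_derivative (f (mixture t P Q)) (at 1 within {0..1}) =
      t *\<^sub>R vector_derivative (f Q) (at t within {0..1})"
    by (intro vector_derivative_within_cbox[of 0 1, simplified]) auto
  then show ?thesis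
    unfolding Psi_inv_def f_def by simp
qed

end

theory Submission
  imports Defs
begin

text \<open>
  Fix \<open>P\<close> and \<open>Q\<close> and look at \<open>f t = D P (mixture t P Q)\<close> on the unit interval. Mixtures of two
  points of the segment from \<open>P\<close> to \<open>Q\<close> are again points of the segment, so right-convexity makes
  \<open>f\<close> a convex function; it is nonnegative and vanishes at \<open>0\<close>, and if \<open>P \<noteq> Q\<close> it vanishes nowhere
  else, because then the segment returns to \<open>P\<close> only at \<open>t = 0\<close>. Everything follows from these
  properties of \<open>f\<close>.

  A convex \<open>f\<close> with \<open>f 0 = 0\<close> has nondecreasing chord slopes \<open>f s / s\<close>. So the integrand of \<open>Psi\<close>
  is monotone, hence integrable, and bounded by its value \<open>f 1\<close> at the right end; this gives
  \<open>Psi D P Q \<le> D P Q\<close>. As averages of the values \<open>D P (mixture s P Q)\<close>, which are convex in \<open>Q\<close>,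
  the values of \<open>Psi D\<close> are convex in \<open>Q\<close> as well, and they remain positive for \<open>P \<noteq> Q\<close>. Hence
  \<open>Psi\<close> preserves the class of finite right-convex divergences (\<open>Psi_step\<close>), and all claims about
  the iterates follow by induction. Strict monotonicity is convexity once more: if \<open>P \<noteq> Q\<close>, every
  divergence in this class is strictly increasing along the segment, since
  \<open>f t \<le> (t / u) * f u < f u\<close> for \<open>0 \<le> t < u \<le> 1\<close>.

  For \<open>Psi_inv\<close> the value at \<open>mixture t P Q\<close> is \<open>t * f' t\<close>. The tangent at \<open>t\<close> lies below the graph
  of \<open>f\<close>; at the abscissa \<open>0\<close> this says \<open>t * f' t \<ge> f t\<close>, which yields both the comparison with
  \<open>D\<close> and, for \<open>P \<noteq> Q\<close>, positivity on \<open>(0, 1]\<close>. As \<open>f'\<close> is also nondecreasing, \<open>t * f' t\<close> is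
  then strictly increasing.
\<close>

section \<open>Convex functions on the unit interval\<close>

lemma convex_le_chord_from_zero:
  fixes f :: "real \<Rightarrow> real"
  assumes f: "convex_on {0..1} f" "f 0 = 0" and "0 \<le> t" "t \<le> u" "0 < u" "u \<le> 1"
  shows "f t \<le> t / u * f u"
  using convex_onD[OF f(1), of "t / u" 0 u] assms by simp

lemma convex_chord_slope_mono:
  fixes f :: "real \<Rightarrow> real"
  assumes f: "convex_on {0..1} f" "f 0 = 0" "\<And>t. t \<in> {0..1} \<Longrightarrow> 0 \<le> f t"
  shows "mono_on {0..1} (\<lambda>t. 1 / t * f t)"
proof (rule mono_onI)
  fix t u :: real assume tu: "t \<in> {0..1}" "u \<in> {0..1}" "t \<le> u"
  show "1 / t * f t \<le> 1 / u * f u"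
  proof (cases "t = 0")
    \<comment> \<open>At \<open>t = 0\<close> the quotient has the default value \<open>0\<close>, which does not break monotonicity.\<close>
    case True
    then show ?thesis using f(3)[OF tu(2)] tu by simp
  next
    case False
    then show ?thesis
      using convex_le_chord_from_zero[OF f(1,2), of t u] tu by (simp add: field_simps)
  qed
qed

lemma convex_strict_mono_from_zero:
  fixes f :: "real \<Rightarrow> real"
  assumes f: "convex_on {0..1} f" "f 0 = 0" "\<And>t. t \<in> {0<..1} \<Longrightarrow> 0 < f t"
  shows "strict_mono_on {0..1} f"
proof (rule strict_mono_onI)
  fix t u :: real assume tu: "t \<in> {0..1}" "u \<in> {0..1}" "t < u"
  have "f t \<le> t / u * f u"
    using tu by (intro convex_le_chord_from_zero f) auto
  also have "\<dots> < 1 * f u"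
    using tu f(3)[of u] by (intro mult_strict_right_mono) auto
  finally show "f t < f u" by simp
qed

text \<open>
  The derivative at \<open>x\<close> is the limit of the slopes of the chords from \<open>x\<close> towards \<open>y\<close>, and convexity
  bounds each of these slopes by that of the full chord. The chords stay inside the interval, so the
  argument covers the endpoints, where only a one-sided derivative exists.
\<close>

lemma convex_ge_tangent:
  fixes f :: "real \<Rightarrow> real"
  assumes f: "convex_on {0..1} f" and x: "x \<in> {0..1}" and y: "y \<in> {0..1}"
    and d: "(f has_real_derivative d) (at x within {0..1})"
  shows "d * (y - x) \<le> f y - f x"
proof -
  let ?p = "\<lambda>s. x + s * (y - x)"
  have seg: "?p s = (1 - s) *\<^sub>R x + s *\<^sub>R y" for s
    by (simp add: algebra_simps)
  have sub: "?p ` {0..1} \<subseteq> {0..1}"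
    unfolding seg using x y convexD_alt[of "{0..1::real}" x y] by auto
  have "(f has_real_derivative d) (at (?p 0) within ?p ` {0..1})"
    using DERIV_subset[OF d sub] by simp
  moreover have "(?p has_real_derivative (y - x)) (at 0 within {0..1})"
    by (auto intro!: derivative_eq_intros)
  ultimately have "(f \<circ> ?p has_real_derivative d * (y - x)) (at 0 within {0..1})"
    by (rule DERIV_image_chain)
  then have lim: "((\<lambda>s. (f (?p s) - f x) / s) \<longlongrightarrow> d * (y - x)) (at 0 within {0..1})"
    by (simp add: has_field_derivative_iff)
  have "(f (?p s) - f x) / s \<le> f y - f x" if "s \<in> {0..1}" "s \<noteq> 0" for s
  proof -
    have "f (?p s) \<le> (1 - s) * f x + s * f y"
      unfolding seg using that x y by (intro convex_onD[OF f]) auto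
    then show ?thesis
      using that by (simp add: field_simps)
  qed
  then have "\<forall>\<^sub>F s in at 0 within {0..1}. (f (?p s) - f x) / s \<le> f y - f x"
    by (auto simp: eventually_at_filter)
  moreover have "at (0::real) within {0..1} \<noteq> bot"
    by (simp add: at_within_Icc_at_right)
  ultimately show ?thesis
    using tendsto_upperbound[OF lim] by blast
qed

section \<open>Mixtures\<close>

lemma common_support_probs_sets:
  assumes "P \<in> common_support_probs \<mu>" "Q \<in> common_support_probs \<mu>"
  shows "sets Q = sets P"
  using assms by (simp add: common_support_probs_def)

lemma measure_mixture:
  assumes "P \<in> common_support_probs \<mu>" "Q \<in> common_support_probs \<mu>" "t \<in> {0..1}"
  shows "measure (mixture t P Q) A = (1 - t) * measure P A + t * measure Q A"
proof (cases "A \<in> sets P")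
  case True
  interpret P: prob_space P using assms by (simp add: common_support_probs_def)
  interpret Q: prob_space Q using assms by (simp add: common_support_probs_def)
  have "emeasure (mixture t P Q) A = ennreal ((1 - t) * measure P A + t * measure Q A)"
    using assms True
    by (simp add: emeasure_mixture[OF common_support_probs_sets] P.emeasure_eq_measure
        Q.emeasure_eq_measure ennreal_mult)
  then show ?thesis
    using assms(3) by (intro measure_eq_emeasure_eq_ennreal) auto
next
  case False
  then show ?thesis
    using common_support_probs_sets[OF assms(1,2)] by (simp add: measure_notin_sets)
qed

lemma common_support_probs_eqI:
  assumes "P \<in> common_support_probs \<mu>" "Q \<in> common_support_probs \<mu>"
    and "\<And>A. measure P A = measure Q A"
  shows "P = Q"
proof (rule measure_eqI)
  interpret P: prob_space P using assms by (simp add: common_support_probs_def)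
  interpret Q: prob_space Q using assms by (simp add: common_support_probs_def)
  show "sets P = sets Q" using common_support_probs_sets[OF assms(2,1)] .
  show "emeasure P A = emeasure Q A" for A
    by (simp add: P.emeasure_eq_measure Q.emeasure_eq_measure assms(3))
qed

lemma mixture_on_segment:
  assumes "P \<in> common_support_probs \<mu>" "Q \<in> common_support_probs \<mu>"
    and "a \<in> {0..1}" "b \<in> {0..1}" "l \<in> {0..1}"
  shows "mixture l (mixture a P Q) (mixture b P Q) = mixture ((1 - l) * a + l * b) P Q"
proof (rule common_support_probs_eqI)
  have c: "(1 - l) * a + l * b \<in> {0..1}"
    using convexD_alt[of "{0..1::real}" a b l] assms by auto
  note M = mixture_in_common_support_probs[OF assms(1,2)]
  show "mixture l (mixture a P Q) (mixture b P Q) \<in> common_support_probs \<mu>"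
    and "mixture ((1 - l) * a + l * b) P Q \<in> common_support_probs \<mu>"
    by (rule mixture_in_common_support_probs[OF M[OF assms(3)] M[OF assms(4)] assms(5)], rule M[OF c])
  show "measure (mixture l (mixture a P Q) (mixture b P Q)) A
      = measure (mixture ((1 - l) * a + l * b) P Q) A" for A
    unfolding measure_mixture[OF M[OF assms(3)] M[OF assms(4)] assms(5)]
      measure_mixture[OF assms(1,2,3)] measure_mixture[OF assms(1,2,4)]
      measure_mixture[OF assms(1,2) c]
    by (simp add: algebra_simps)
qed

text \<open>
  Contraction towards \<open>P\<close> is affine; this passes convexity in the second argument through the
  integral over \<open>s\<close>.
\<close>

lemma mixture_distrib:
  assumes "P \<in> common_support_probs \<mu>" "Q1 \<in> common_support_probs \<mu>" "Q2 \<in> common_support_probs \<mu>"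
    and "s \<in> {0..1}" "l \<in> {0..1}"
  shows "mixture s P (mixture l Q1 Q2) = mixture l (mixture s P Q1) (mixture s P Q2)"
proof (rule common_support_probs_eqI)
  note M = mixture_in_common_support_probs
  show "mixture s P (mixture l Q1 Q2) \<in> common_support_probs \<mu>"
    and "mixture l (mixture s P Q1) (mixture s P Q2) \<in> common_support_probs \<mu>"
    by (rule M[OF assms(1) M[OF assms(2,3,5)] assms(4)],
        rule M[OF M[OF assms(1,2,4)] M[OF assms(1,3,4)] assms(5)])
  show "measure (mixture s P (mixture l Q1 Q2)) A
      = measure (mixture l (mixture s P Q1) (mixture s P Q2)) A" for A
    unfolding measure_mixture[OF assms(1) M[OF assms(2,3,5)] assms(4)]
      measure_mixture[OF M[OF assms(1,2,4)] M[OF assms(1,3,4)] assms(5)]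
      measure_mixture[OF assms(2,3,5)] measure_mixture[OF assms(1,2,4)]
      measure_mixture[OF assms(1,3,4)]
    by (simp add: algebra_simps)
qed

text \<open>
  A segment to some \<open>Q \<noteq> P\<close> leaves \<open>P\<close> at once and never returns; this is why a divergence is
  positive along it.
\<close>

lemma mixture_eq_left_iff:
  assumes "P \<in> common_support_probs \<mu>" "Q \<in> common_support_probs \<mu>" "t \<in> {0..1}"
  shows "mixture t P Q = P \<longleftrightarrow> t = 0 \<or> P = Q"
proof
  assume eq: "mixture t P Q = P"
  have "t = 0 \<or> measure P A = measure Q A" for A
  proof -
    have "t * measure P A = t * measure Q A"
      using measure_mixture[OF assms, of A] unfolding eq by (auto simp: left_diff_distrib)
    then show ?thesis by simp
  qed
  then show "t = 0 \<or> P = Q"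
    using common_support_probs_eqI[OF assms(1,2)] by blast
next
  assume "t = 0 \<or> P = Q"
  then have "measure (mixture t P Q) A = measure P A" for A
    unfolding measure_mixture[OF assms] by (auto simp: algebra_simps)
  then show "mixture t P Q = P"
    by (rule common_support_probs_eqI[OF mixture_in_common_support_probs[OF assms] assms(1)])
qed

section \<open>Finite right-convex divergences and the integral operator\<close>

text \<open>
  A class that contains every differentiable right-convex divergence and is preserved by \<open>Psi\<close>
  (\<open>Psi_step\<close>). Finiteness stands in for differentiability here, because convexity along segments
  already makes the integrand of \<open>Psi\<close> monotone.
\<close>

locale finite_convex_divergence =
  fixes \<mu> :: "'a measure" and E :: "'a measure \<Rightarrow> 'a measure \<Rightarrow> ereal"
  assumes divergence: "divergence (common_support_probs \<mu>) E"
    and convex: "right_convex (common_support_probs \<mu>) E"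
    and finite: "\<lbrakk>P \<in> common_support_probs \<mu>; Q \<in> common_support_probs \<mu>\<rbrakk> \<Longrightarrow> \<bar>E P Q\<bar> \<noteq> \<infinity>"
begin

definition val :: "'a measure \<Rightarrow> 'a measure \<Rightarrow> real" where
  "val P Q = real_of_ereal (E P Q)"

lemma E_eq_val:
  assumes "P \<in> common_support_probs \<mu>" "Q \<in> common_support_probs \<mu>"
  shows "E P Q = ereal (val P Q)"
  using finite[OF assms] by (simp add: val_def ereal_real)

lemma val_nonneg:
  assumes "P \<in> common_support_probs \<mu>" "Q \<in> common_support_probs \<mu>"
  shows "0 \<le> val P Q"
  using divergence assms E_eq_val[OF assms] unfolding divergence_def by fastforce

lemma val_eq_0_iff:
  assumes "P \<in> common_support_probs \<mu>" "Q \<in> common_support_probs \<mu>"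
  shows "val P Q = 0 \<longleftrightarrow> P = Q"
  using divergence assms E_eq_val[OF assms] unfolding divergence_def by fastforce

lemma val_mixture_le:
  assumes "P \<in> common_support_probs \<mu>" "Q1 \<in> common_support_probs \<mu>" "Q2 \<in> common_support_probs \<mu>"
    and "l \<in> {0..1}"
  shows "val P (mixture l Q1 Q2) \<le> (1 - l) * val P Q1 + l * val P Q2"
proof -
  have "E P (mixture l Q1 Q2) \<le> ereal l * E P Q2 + ereal (1 - l) * E P Q1"
    using convex assms unfolding right_convex_def by blast
  then show ?thesis
    using assms mixture_in_common_support_probs[OF assms(2,3,4)] by (simp add: E_eq_val)
qed

context
  fixes P Q assumes PQ: "P \<in> common_support_probs \<mu>" "Q \<in> common_support_probs \<mu>"
begin

lemma convex_on_segment: "convex_on {0..1} (\<lambda>t. val P (mixture t P Q))"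
proof (rule convex_onI)
  fix l a b :: real assume *: "0 < l" "l < 1" "a \<in> {0..1}" "b \<in> {0..1}"
  have "mixture ((1 - l) *\<^sub>R a + l *\<^sub>R b) P Q = mixture l (mixture a P Q) (mixture b P Q)"
    using mixture_on_segment[OF PQ *(3,4), of l] * by simp
  then show "val P (mixture ((1 - l) *\<^sub>R a + l *\<^sub>R b) P Q)
      \<le> (1 - l) * val P (mixture a P Q) + l * val P (mixture b P Q)"
    using val_mixture_le[OF PQ(1) mixture_in_common_support_probs[OF PQ *(3)]
        mixture_in_common_support_probs[OF PQ *(4)], of l] * by simp
qed simp

lemma val_segment_0: "val P (mixture 0 P Q) = 0"
  using val_eq_0_iff[OF PQ(1,1)] common_support_probs_sets[OF PQ] by simp

lemma val_segment_1: "val P (mixture 1 P Q) = val P Q"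
  using common_support_probs_sets[OF PQ] by simp

lemma val_segment_nonneg: "t \<in> {0..1} \<Longrightarrow> 0 \<le> val P (mixture t P Q)"
  by (intro val_nonneg mixture_in_common_support_probs PQ)

lemma val_segment_pos:
  assumes "P \<noteq> Q" "t \<in> {0<..1}"
  shows "0 < val P (mixture t P Q)"
proof -
  have t: "t \<in> {0..1}" using assms by auto
  have "val P (mixture t P Q) \<noteq> 0"
    using assms mixture_eq_left_iff[OF PQ t]
      val_eq_0_iff[OF PQ(1) mixture_in_common_support_probs[OF PQ t]] by auto
  then show ?thesis using val_segment_nonneg[OF t] by simp
qed

lemma strict_mono_on_segment:
  assumes "P \<noteq> Q"
  shows "strict_mono_on {0..1} (\<lambda>t. E P (mixture t P Q))"
proof -
  have "strict_mono_on {0..1} (\<lambda>t. val P (mixture t P Q))"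
    using convex_strict_mono_from_zero[OF convex_on_segment val_segment_0 val_segment_pos[OF assms]] .
  then show ?thesis
    using mixture_in_common_support_probs[OF PQ] PQ
    by (simp add: strict_mono_on_def E_eq_val)
qed

lemma slope_mono_on: "mono_on {0..1} (\<lambda>s. 1 / s * val P (mixture s P Q))"
  by (rule convex_chord_slope_mono[OF convex_on_segment val_segment_0 val_segment_nonneg])

lemma slope_integrable_on: "(\<lambda>s. 1 / s * val P (mixture s P Q)) integrable_on {0..1}"
  by (rule integrable_on_mono_on[OF slope_mono_on])

lemma slope_integrable: "(\<lambda>s. 1 / s * val P (mixture s P Q)) absolutely_integrable_on {0..1}"
  using val_segment_nonneg
  by (intro nonnegative_absolutely_integrable_1 slope_integrable_on) auto

lemma Psi_eq_integral: "Psi E P Q = ereal (integral {0..1} (\<lambda>s. 1 / s * val P (mixture s P Q)))"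
  using set_lebesgue_integral_eq_integral(2)[OF slope_integrable] by (simp add: Psi_def val_def)

lemma Psi_le: "Psi E P Q \<le> E P Q"
proof -
  have "1 / s * val P (mixture s P Q) \<le> val P Q" if "s \<in> {0..1}" for s
    using mono_onD[OF slope_mono_on that, of 1] that val_segment_1 by simp
  then have "integral {0..1} (\<lambda>s. 1 / s * val P (mixture s P Q)) \<le> integral {0..1} (\<lambda>s::real. val P Q)"
    by (intro integral_le slope_integrable_on) auto
  then show ?thesis by (simp add: Psi_eq_integral E_eq_val[OF PQ])
qed

lemma Psi_nonneg: "0 \<le> Psi E P Q"
proof -
  have "0 \<le> integral {0..1} (\<lambda>s. 1 / s * val P (mixture s P Q))"
    using val_segment_nonneg by (intro integral_nonneg slope_integrable_on) auto
  then show ?thesis by (simp add: Psi_eq_integral)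
qed

text \<open>
  The integrand may tend to \<open>0\<close> at \<open>0\<close> arbitrarily fast, so the lower bound comes from the right
  half of the interval, on which the slope is at least its value at the midpoint, a positive number.
\<close>

lemma Psi_pos:
  assumes "P \<noteq> Q"
  shows "0 < Psi E P Q"
proof -
  define g where "g s = 1 / s * val P (mixture s P Q)" for s
  have mono: "mono_on {0..1} g" using slope_mono_on by (simp add: g_def[abs_def])
  have g: "g integrable_on {0..1}" using slope_integrable_on by (simp add: g_def[abs_def])
  then have g2: "g integrable_on {1/2..1}"
    by (rule integrable_on_subinterval) auto
  have "0 < g (1/2) / 2"
    using val_segment_pos[OF assms, of "1/2"] by (simp add: g_def)
  also have "g (1/2) / 2 = integral {1/2..1} (\<lambda>s::real. g (1/2))"
    by simp
  also have "\<dots> \<le> integral {1/2..1} g"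
    by (intro integral_le g2) (auto intro: mono_onD[OF mono])
  also have "\<dots> \<le> integral {0..1} g"
    using val_segment_nonneg by (intro integral_subset_le g g2) (auto simp: g_def)
  finally show ?thesis by (simp add: Psi_eq_integral g_def[abs_def])
qed

end

lemma Psi_integrable: "Psi_integrable (common_support_probs \<mu>) E"
  unfolding Psi_integrable_def
proof (intro ballI conjI)
  fix P Q assume PQ: "P \<in> common_support_probs \<mu>" "Q \<in> common_support_probs \<mu>"
  show "AE t in lebesgue. t \<in> {0..1} \<longrightarrow> \<bar>E P (mixture t P Q)\<bar> \<noteq> \<infinity>"
    by (intro AE_I2 impI finite[OF PQ(1)] mixture_in_common_support_probs[OF PQ])
  show "(\<lambda>t. 1 / t * real_of_ereal (E P (mixture t P Q))) absolutely_integrable_on {0..1}"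
    using slope_integrable[OF PQ] unfolding val_def .
qed

lemma Psi_divergence: "divergence (common_support_probs \<mu>) (Psi E)"
  unfolding divergence_def
proof (intro ballI conjI)
  fix P Q assume PQ: "P \<in> common_support_probs \<mu>" "Q \<in> common_support_probs \<mu>"
  show "Psi E P Q \<ge> 0" by (rule Psi_nonneg[OF PQ])
  have "Psi E P P \<le> 0"
    using Psi_le[OF PQ(1,1)] divergence PQ(1) unfolding divergence_def by metis
  then show "Psi E P Q = 0 \<longleftrightarrow> P = Q"
    using Psi_pos[OF PQ] Psi_nonneg[OF PQ] by (metis antisym less_irrefl)
qed

lemma Psi_right_convex: "right_convex (common_support_probs \<mu>) (Psi E)"
  unfolding right_convex_def
proof (intro ballI)
  fix P Q1 Q2 and l :: real
  assume P: "P \<in> common_support_probs \<mu>" and Q1: "Q1 \<in> common_support_probs \<mu>"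
    and Q2: "Q2 \<in> common_support_probs \<mu>" and l: "l \<in> {0..1}"
  let ?R = "mixture l Q2 Q1"
  let ?g = "\<lambda>Q s. 1 / s * val P (mixture s P Q)"
  have R: "?R \<in> common_support_probs \<mu>"
    by (rule mixture_in_common_support_probs[OF Q2 Q1 l])
  have "?g ?R s \<le> l * ?g Q1 s + (1 - l) * ?g Q2 s" if s: "s \<in> {0..1}" for s
  proof -
    have "val P (mixture s P ?R) \<le> (1 - l) * val P (mixture s P Q2) + l * val P (mixture s P Q1)"
      unfolding mixture_distrib[OF P Q2 Q1 s l]
      by (intro val_mixture_le mixture_in_common_support_probs P Q1 Q2 s l)
    then have "?g ?R s
        \<le> 1 / s * ((1 - l) * val P (mixture s P Q2) + l * val P (mixture s P Q1))"
      using s by (intro mult_left_mono) auto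
    then show ?thesis by (simp add: algebra_simps diff_divide_distrib)
  qed
  moreover have int: "(\<lambda>s. l * ?g Q1 s + (1 - l) * ?g Q2 s) integrable_on {0..1}"
    using slope_integrable_on[OF P Q1] slope_integrable_on[OF P Q2]
    by (intro integrable_add integrable_on_mult_right)
  ultimately have "integral {0..1} (?g ?R)
      \<le> integral {0..1} (\<lambda>s. l * ?g Q1 s + (1 - l) * ?g Q2 s)"
    by (intro integral_le slope_integrable_on[OF P R])
  also have "\<dots> = l * integral {0..1} (?g Q1) + (1 - l) * integral {0..1} (?g Q2)"
    using slope_integrable_on[OF P Q1] slope_integrable_on[OF P Q2]
    by (subst integral_add) (auto intro!: integrable_on_mult_right simp del: times_divide_eq_left)
  finally show "Psi E P ?R \<le> ereal l * Psi E P Q1 + ereal (1 - l) * Psi E P Q2"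
    using P Q1 Q2 R by (simp add: Psi_eq_integral)
qed

lemma Psi_step: "finite_convex_divergence \<mu> (Psi E)"
  by (intro finite_convex_divergence.intro Psi_divergence Psi_right_convex) (simp add: Psi_def)

end

lemma Psi_funpow:
  assumes "finite_convex_divergence \<mu> E"
  shows "finite_convex_divergence \<mu> ((Psi ^^ k) E)"
  by (induction k) (simp_all add: assms finite_convex_divergence.Psi_step)

section \<open>The differential operator\<close>

locale differentiable_convex_divergence = finite_convex_divergence +
  assumes differentiable: "divergence_differentiable (common_support_probs \<mu>) E"
begin

definition slope :: "'a measure \<Rightarrow> 'a measure \<Rightarrow> real \<Rightarrow> real" where
  "slope P Q t = vector_derivative (\<lambda>s. val P (mixture s P Q)) (at t within {0..1})"

context
  fixes P Q assumes PQ: "P \<in> common_support_probs \<mu>" "Q \<in> common_support_probs \<mu>"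
begin

lemma Psi_inv_eq_slope:
  "t \<in> {0..1} \<Longrightarrow> Psi_inv E P (mixture t P Q) = ereal (t * slope P Q t)"
  using Psi_inv_mixture[OF differentiable PQ] by (simp add: slope_def val_def)

lemma val_ge_tangent:
  assumes "t \<in> {0..1}" "u \<in> {0..1}"
  shows "slope P Q t * (u - t) \<le> val P (mixture u P Q) - val P (mixture t P Q)"
proof (rule convex_ge_tangent[OF convex_on_segment[OF PQ] assms])
  have "(\<lambda>s. val P (mixture s P Q)) differentiable at t within {0..1}"
    using differentiable PQ assms
    unfolding divergence_differentiable_def differentiable_on_def val_def by blast
  then show "((\<lambda>s. val P (mixture s P Q)) has_real_derivative slope P Q t) (at t within {0..1})"
    by (simp add: slope_def vector_derivative_works has_real_derivative_iff_has_vector_derivative)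
qed

lemma val_le_slope: "t \<in> {0..1} \<Longrightarrow> val P (mixture t P Q) \<le> t * slope P Q t"
  using val_ge_tangent[of t 0] val_segment_0[OF PQ] by (simp add: mult.commute)

text \<open>Adding the tangent inequalities at \<open>t\<close> and at \<open>u\<close> cancels the function values.\<close>

lemma slope_mono:
  assumes "t \<in> {0..1}" "u \<in> {0..1}" "t < u"
  shows "slope P Q t \<le> slope P Q u"
proof -
  have "slope P Q t * (u - t) \<le> slope P Q u * (u - t)"
    using val_ge_tangent[OF assms(1,2)] val_ge_tangent[OF assms(2,1)]
    by (simp add: algebra_simps)
  then show ?thesis using assms(3) by simp
qed

lemma Psi_inv_ge:
  assumes "t \<in> {0..1}"
  shows "E P (mixture t P Q) \<le> Psi_inv E P (mixture t P Q)"
  using val_le_slope[OF assms] assms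
  by (simp add: Psi_inv_eq_slope E_eq_val PQ mixture_in_common_support_probs[OF PQ assms])

lemma Psi_inv_strict_mono_on_segment:
  assumes "P \<noteq> Q"
  shows "strict_mono_on {0..1} (\<lambda>t. Psi_inv E P (mixture t P Q))"
proof (rule strict_mono_onI)
  fix t u :: real assume tu: "t \<in> {0..1}" "u \<in> {0..1}" "t < u"
  have "0 < u * slope P Q u"
    using val_segment_pos[OF PQ assms, of u] val_le_slope[OF tu(2)] tu by simp
  then have pos: "0 < slope P Q u"
    using tu by (simp add: zero_less_mult_iff)
  have "t * slope P Q t \<le> t * slope P Q u"
    using slope_mono[OF tu] tu by (intro mult_left_mono) auto
  also have "\<dots> < u * slope P Q u"
    using tu(3) pos by (rule mult_strict_right_mono)
  finally show "Psi_inv E P (mixture t P Q) < Psi_inv E P (mixture u P Q)"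
    using tu by (simp add: Psi_inv_eq_slope)
qed

end

lemma Psi_inv_divergence: "divergence (common_support_probs \<mu>) (Psi_inv E)"
  unfolding divergence_def
proof (intro ballI conjI)
  fix P Q assume PQ: "P \<in> common_support_probs \<mu>" "Q \<in> common_support_probs \<mu>"
  have ge: "E P Q \<le> Psi_inv E P Q"
    using Psi_inv_ge[OF PQ, of 1] common_support_probs_sets[OF PQ] by simp
  then show "Psi_inv E P Q \<ge> 0"
    using divergence PQ unfolding divergence_def by (meson order_trans)
  \<comment> \<open>The formula \<open>t * f' t\<close> at \<open>t = 0\<close>.\<close>
  have "Psi_inv E P P = 0"
    using Psi_inv_eq_slope[OF PQ(1,1), of 0] by (simp add: zero_ereal_def)
  moreover have "P = Q" if "Psi_inv E P Q = 0"
    using ge that divergence PQ unfolding divergence_def by (metis antisym)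
  ultimately show "Psi_inv E P Q = 0 \<longleftrightarrow> P = Q" by blast
qed

end

section \<open>The chain of divergences\<close>

theorem theorem3:
  fixes \<mu> :: "'a measure" and \<P> :: "'a measure set"
    and D :: "'a measure \<Rightarrow> 'a measure \<Rightarrow> ereal"
  assumes \<P>: "\<P> = common_support_probs \<mu>"
    and D: "divergence \<P> D" "right_convex \<P> D" "divergence_differentiable \<P> D"
  shows "divergence \<P> (Psi_inv D)
    \<and> (\<forall>k. Psi_integrable \<P> ((Psi ^^ k) D))
    \<and> (\<forall>k\<ge>1. divergence \<P> ((Psi ^^ k) D) \<and> right_convex \<P> ((Psi ^^ k) D))
    \<and> (\<forall>P\<in>\<P>. \<forall>Q\<in>\<P>. \<forall>t\<in>{0..1}.
         Psi_inv D P (mixture t P Q) \<ge> D P (mixture t P Q)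
         \<and> (\<forall>k. (Psi ^^ k) D P (mixture t P Q) \<ge> (Psi ^^ Suc k) D P (mixture t P Q))
         \<and> (\<forall>k. (Psi ^^ k) D P (mixture t P Q) \<ge> 0))
    \<and> (\<forall>P\<in>\<P>. \<forall>Q\<in>\<P>. P \<noteq> Q \<longrightarrow>
         strict_mono_on {0..1} (\<lambda>t. Psi_inv D P (mixture t P Q))
         \<and> (\<forall>k\<ge>1. strict_mono_on {0..1} (\<lambda>t. (Psi ^^ k) D P (mixture t P Q))))"
proof -
  have fin: "\<bar>D P Q\<bar> \<noteq> \<infinity>" if PQ: "P \<in> \<P>" "Q \<in> \<P>" for P Q
  proof -
    have "\<bar>D P (mixture 1 P Q)\<bar> \<noteq> \<infinity>"
      using D(3) PQ unfolding divergence_differentiable_def by auto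
    then show ?thesis
      using PQ common_support_probs_sets[of P \<mu> Q] by (simp add: \<P>)
  qed
  interpret D: differentiable_convex_divergence \<mu> D
    by unfold_locales (use D fin in \<open>simp_all add: \<P>\<close>)
  have K: "finite_convex_divergence \<mu> ((Psi ^^ k) D)" for k
    by (rule Psi_funpow) unfold_locales
  show ?thesis
    unfolding \<P>
  proof (intro conjI ballI allI impI)
    fix k
    show "Psi_integrable (common_support_probs \<mu>) ((Psi ^^ k) D)"
      and "divergence (common_support_probs \<mu>) ((Psi ^^ k) D)"
      and "right_convex (common_support_probs \<mu>) ((Psi ^^ k) D)"
      using finite_convex_divergence.Psi_integrable[OF K] finite_convex_divergence.divergence[OF K]
        finite_convex_divergence.convex[OF K] by blast+
  next
    fix P Q k and t :: real
    assume PQ: "P \<in> common_support_probs \<mu>" "Q \<in> common_support_probs \<mu>" and t: "t \<in> {0..1}"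
    note R = mixture_in_common_support_probs[OF PQ t]
    show "D P (mixture t P Q) \<le> Psi_inv D P (mixture t P Q)"
      by (rule D.Psi_inv_ge[OF PQ t])
    show "(Psi ^^ Suc k) D P (mixture t P Q) \<le> (Psi ^^ k) D P (mixture t P Q)"
      using finite_convex_divergence.Psi_le[OF K PQ(1) R] by simp
    show "0 \<le> (Psi ^^ k) D P (mixture t P Q)"
      using finite_convex_divergence.divergence[OF K] PQ(1) R unfolding divergence_def by blast
  next
    fix P Q k
    assume PQ: "P \<in> common_support_probs \<mu>" "Q \<in> common_support_probs \<mu>" and ne: "P \<noteq> Q"
    show "strict_mono_on {0..1} (\<lambda>t. Psi_inv D P (mixture t P Q))"
      by (rule D.Psi_inv_strict_mono_on_segment[OF PQ ne])
    show "strict_mono_on {0..1} (\<lambda>t. (Psi ^^ k) D P (mixture t P Q))"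
      by (rule finite_convex_divergence.strict_mono_on_segment[OF K PQ ne])
  qed (rule D.Psi_inv_divergence)
qed

end
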